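(* The set of all integer partitions is a disjoint union of Boolean classes under diagonal-block flips. A class with $k$ diagonal blocks contains exactly $2^k$ partitions, all of the same size, and contains a unique member of $\mathcal P^+$. In other words, $$\sum_{\lambda\in\mathcal P^+}2^{\kappa(\lambda)}q^{|\lambda|}=\frac{1}{(q;q)_\infty},\qquad (q;q)_\infty=\prod_{j\ge1}(1-q^j).$$
   Context: Let $\lambda$ be a partition with conjugate $\lambda'$ and Durfee size $d$ (the side of the largest square contained in the Young diagram of $\lambda$). Put $\alpha_i=\lambda_i-d$ and $\beta_i=\lambda_i'-d$ for $1\le i\le d$. Then $\alpha=(\alpha_1,\dots,\alpha_d)$ (the upper wing) and $\beta=(\beta_1,\dots,\beta_d)$ (the lower wing, reflected in the main diagonal) are partitions with at most $d$ parts, $|\lambda|=d^2+|\alpha|+|\beta|$, and $(d,\alpha,\beta)$ determines $\lambda$. Put $I_i=\min(\alpha_i,\beta_i)$ and $U_i=\max(\alpha_i,\beta_i)$. The edge-connected components of the skew diagram $U/I$ (cells adjacent when they share an edge) are the diagonal blocks of $\lambda$; $\kappa(\lambda)$ is their number. Every diagonal block lies entirely in $\alpha\setminus\beta$ or entirely in $\beta\setminus\alpha$ (as sets of cells); flipping a diagonal block means moving all its cells from the one of $\alpha,\beta$ that contains it to the other, keeping $d$ and everything else fixed. The class of $\lambda$ is the set of all partitions obtained from $\lambda$ by flipping arbitrary subsets of its diagonal blocks (equivalently, all partitions with the same data $d$, $I$, $U$); "Boolean" means that the blocks can be flipped independently, each choice of wing for each block giving a partition. The successive ranks of $\lambda$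 are $\sigma_i(\lambda)=\lambda_i-\lambda_i'=\alpha_i-\beta_i$, $1\le i\le d$. $\mathcal P^+$ is the set of all partitions whose successive ranks are all nonnegative (including the empty partition). *)

theory Defs
  imports "HOL-Analysis.Analysis"
begin

(* A partition is a weakly decreasing, finitely supported sequence of natural numbers.
   Indices start at 0, so l i is the part usually written lambda_(i+1). *)

definition partitions :: "(nat \<Rightarrow> nat) set" where
  "partitions = {l. antimono l \<and> finite {i. l i \<noteq> 0}}"

definition psize :: "(nat \<Rightarrow> nat) \<Rightarrow> nat" where
  "psize l = (\<Sum>i | l i \<noteq> 0. l i)"

definition conj_part :: "(nat \<Rightarrow> nat) \<Rightarrow> nat \<Rightarrow> nat" where
  "conj_part l j = card {i. j < l i}"

(* The cell (i, j) lies in row i and column j, both counted from 0. *)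
definition diagram :: "(nat \<Rightarrow> nat) \<Rightarrow> (nat \<times> nat) set" where
  "diagram l = {(i, j). j < l i}"

definition durfee :: "(nat \<Rightarrow> nat) \<Rightarrow> nat" where
  "durfee l = (GREATEST d. {..<d} \<times> {..<d} \<subseteq> diagram l)"

(* For a partition l and i < durfee l, both l i and conj_part l i are at least durfee l,
   so the natural-number subtractions below do not truncate. *)

definition upper_wing :: "(nat \<Rightarrow> nat) \<Rightarrow> nat \<Rightarrow> nat" where
  "upper_wing l i = (if i < durfee l then l i - durfee l else 0)"

definition lower_wing :: "(nat \<Rightarrow> nat) \<Rightarrow> nat \<Rightarrow> nat" where
  "lower_wing l i = (if i < durfee l then conj_part l i - durfee l else 0)"

definition inner_shape :: "(nat \<Rightarrow> nat) \<Rightarrow> nat \<Rightarrow> nat" where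
  "inner_shape l i = min (upper_wing l i) (lower_wing l i)"

definition outer_shape :: "(nat \<Rightarrow> nat) \<Rightarrow> nat \<Rightarrow> nat" where
  "outer_shape l i = max (upper_wing l i) (lower_wing l i)"

definition edge_adjacent :: "nat \<times> nat \<Rightarrow> nat \<times> nat \<Rightarrow> bool" where
  "edge_adjacent c c' \<longleftrightarrow>
     fst c = fst c' \<and> (snd c' = Suc (snd c) \<or> snd c = Suc (snd c')) \<or>
     snd c = snd c' \<and> (fst c' = Suc (fst c) \<or> fst c = Suc (fst c'))"

definition edge_components :: "(nat \<times> nat) set \<Rightarrow> (nat \<times> nat) set set" where
  "edge_components S = S // {(c, c'). c \<in> S \<and> c' \<in> S \<and> edge_adjacent c c'}\<^sup>*"

definition diagonal_blocks :: "(nat \<Rightarrow> nat) \<Rightarrow> (nat \<times> nat) set set" where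
  "diagonal_blocks l = edge_components (diagram (outer_shape l) - diagram (inner_shape l))"

definition kappa :: "(nat \<Rightarrow> nat) \<Rightarrow> nat" where
  "kappa l = card (diagonal_blocks l)"

(* move_blocks \<B> X Y is the new cell set of the wing with cells X, when the other wing has
   cells Y: the blocks of \<B> contained in X \ Y leave it, those contained in Y \ X enter it. *)
definition move_blocks ::
  "(nat \<times> nat) set set \<Rightarrow> (nat \<times> nat) set \<Rightarrow> (nat \<times> nat) set \<Rightarrow> (nat \<times> nat) set" where
  "move_blocks \<B> X Y = (X - \<Union>{B \<in> \<B>. B \<subseteq> X - Y}) \<union> \<Union>{B \<in> \<B>. B \<subseteq> Y - X}"

(* The partition m arises from l by flipping exactly the blocks in \<B>. *)
definition is_flip :: "(nat \<times> nat) set set \<Rightarrow> (nat \<Rightarrow> nat) \<Rightarrow> (nat \<Rightarrow> nat) \<Rightarrow> bool" where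
  "is_flip \<B> l m \<longleftrightarrow> m \<in> partitions \<and> durfee m = durfee l \<and>
     diagram (upper_wing m) =
       move_blocks \<B> (diagram (upper_wing l)) (diagram (lower_wing l)) \<and>
     diagram (lower_wing m) =
       move_blocks \<B> (diagram (lower_wing l)) (diagram (upper_wing l))"

definition flip_class :: "(nat \<Rightarrow> nat) \<Rightarrow> (nat \<Rightarrow> nat) set" where
  "flip_class l = {m. \<exists>\<B> \<subseteq> diagonal_blocks l. is_flip \<B> l m}"

definition flip_classes :: "(nat \<Rightarrow> nat) set set" where
  "flip_classes = flip_class ` partitions"

(* is_flip only relates l to actual partitions, so existence says that
   every choice of blocks to be flipped yields a partition. *)
definition boolean_class :: "(nat \<Rightarrow> nat) set \<Rightarrow> bool" where
  "boolean_class C \<longleftrightarrow> (\<forall>l\<in>C. \<forall>\<B> \<subseteq> diagonal_blocks l. \<exists>!m. m \<in> C \<and> is_flip \<B> l m)"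

definition succ_rank :: "(nat \<Rightarrow> nat) \<Rightarrow> nat \<Rightarrow> int" where
  "succ_rank l i = int (l i) - int (conj_part l i)"

definition P_plus :: "(nat \<Rightarrow> nat) set" where
  "P_plus = {l \<in> partitions. \<forall>i < durfee l. 0 \<le> succ_rank l i}"

(* (q; q)_infinity as a formal power series in q, the infinite product being
   taken in the q-adic topology. *)
definition euler_prod :: "rat fps" where
  "euler_prod = (\<Prod>j. 1 - fps_X ^ Suc j)"

end

theory Submission
  imports Defs "HOL-Library.Disjoint_Sets"
begin

text \<open>
  A partition amounts to its Durfee size \<open>d\<close> and the cell sets \<open>X\<close>, \<open>Y\<close> of its two wings, which
  range over all pairs of Young diagrams with at most \<open>d\<close> rows. A diagonal block is a component of
  the symmetric difference of \<open>X\<close> and \<open>Y\<close> and lies on one side of it, so flipping a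
  set of blocks with union \<open>T\<close> replaces \<open>X\<close> and \<open>Y\<close> by their symmetric differences with \<open>T\<close>.
  This preserves \<open>X \<union> Y\<close> and \<open>X \<inter> Y\<close>, hence the size and the blocks, and flips compose
  like symmetric differences of sets of blocks. The partition lies in \<open>P_plus\<close> iff \<open>Y \<subseteq> X\<close>, which
  happens for exactly one choice of blocks. Counting all partitions class by class then reduces
  the identity to Euler's generating function.
\<close>

section \<open>Young diagrams and wings\<close>

text \<open>Turns the cardinalities behind \<open>conj_part\<close> and behind the row lengths in
  \<open>young_eq_diagram\<close> into membership conditions.\<close>

lemma down_set_eq_lessThan_card:
  fixes A :: "nat set"
  assumes "finite A" and "\<And>i j. i \<in> A \<Longrightarrow> j \<le> i \<Longrightarrow> j \<in> A"
  shows "A = {..<card A}"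
proof (cases "A = {}")
  case False
  with assms have "A = {..Max A}" by (auto intro: Max_ge Max_in)
  then show ?thesis by (metis card_atMost lessThan_Suc_atMost)
qed simp

text \<open>Flips act on cells, so shapes are treated as cell sets; \<open>young_eq_diagram\<close>
  leads back to sequences.\<close>

definition young :: "(nat \<times> nat) set \<Rightarrow> bool" where
  "young X \<longleftrightarrow> finite X \<and> (\<forall>i j i' j'. (i, j) \<in> X \<longrightarrow> i' \<le> i \<longrightarrow> j' \<le> j \<longrightarrow> (i', j') \<in> X)"

text \<open>Closure under single steps suffices, by induction on each coordinate; single steps are
  also what edge adjacency speaks about.\<close>

lemma youngI:
  assumes "finite X"
    and "\<And>i j. (Suc i, j) \<in> X \<Longrightarrow> (i, j) \<in> X"
    and "\<And>i j. (i, Suc j) \<in> X \<Longrightarrow> (i, j) \<in> X"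
  shows "young X"
proof -
  have "(i', j') \<in> X" if "(i, j) \<in> X" "i' \<le> i" "j' \<le> j" for i j i' j'
  proof -
    have "(i', j) \<in> X"
      using \<open>i' \<le> i\<close> \<open>(i, j) \<in> X\<close> by (induction rule: inc_induct) (auto intro: assms)
    with \<open>j' \<le> j\<close> show ?thesis by (induction rule: inc_induct) (auto intro: assms)
  qed
  with assms(1) show ?thesis by (auto simp: young_def)
qed

lemma young_finite: "young X \<Longrightarrow> finite X"
  by (simp add: young_def)

lemma young_mono: "young X \<Longrightarrow> (i, j) \<in> X \<Longrightarrow> i' \<le> i \<Longrightarrow> j' \<le> j \<Longrightarrow> (i', j') \<in> X"
  by (auto simp: young_def)

lemma mem_diagram [simp]: "(i, j) \<in> diagram l \<longleftrightarrow> j < l i"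
  by (simp add: diagram_def)

lemma diagram_eq_iff: "diagram l = diagram m \<longleftrightarrow> l = m"
proof
  assume *: "diagram l = diagram m"
  have "j < l i \<longleftrightarrow> j < m i" for i j using * by (metis mem_diagram)
  then have "l i = m i" for i by (meson linorder_neqE_nat nat_less_le)
  then show "l = m" by blast
qed simp

lemma diagram_eq_Sigma: "diagram l = Sigma {i. l i \<noteq> 0} (\<lambda>i. {..<l i})"
  by (auto simp: diagram_def)

lemma young_diagram: "l \<in> partitions \<Longrightarrow> young (diagram l)"
proof -
  assume l: "l \<in> partitions"
  then have "finite (diagram l)"
    unfolding diagram_eq_Sigma by (auto simp: partitions_def)
  with l show ?thesis
    by (force simp: young_def partitions_def dest!: antimonoD)
qed

lemma psize_eq_card: "l \<in> partitions \<Longrightarrow> psize l = card (diagram l)"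
  unfolding diagram_eq_Sigma psize_def by (simp add: partitions_def)

lemma young_eq_diagram:
  assumes "young X"
  obtains l where "l \<in> partitions" "diagram l = X"
proof
  define l where "l = (\<lambda>i. card {j. (i, j) \<in> X})"
  have fin: "finite {j. (i, j) \<in> X}" for i
    using finite_vimageI[of X "Pair i"] young_finite[OF assms] by (simp add: vimage_def inj_def)
  have "{j. (i, j) \<in> X} = {..<l i}" for i
    unfolding l_def using assms by (intro down_set_eq_lessThan_card fin) (auto dest: young_mono)
  then have mem: "(i, j) \<in> X \<longleftrightarrow> j < l i" for i j by blast
  then show diag: "diagram l = X" by auto
  have "antimono l"
    unfolding l_def by (intro antimonoI card_mono fin) (auto dest: young_mono[OF assms])
  moreover have "{i. l i \<noteq> 0} \<subseteq> fst ` X"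
    using mem by (force simp: image_iff)
  then have "finite {i. l i \<noteq> 0}"
    using young_finite[OF assms] finite_surj by blast
  ultimately show "l \<in> partitions" by (simp add: partitions_def)
qed

text \<open>Transposition on the level of cells: the rows longer than \<open>i\<close> form an
  initial segment, and \<open>conj_part l i\<close> is its length.\<close>

lemma less_conj_part_iff:
  assumes "l \<in> partitions"
  shows "j < conj_part l i \<longleftrightarrow> i < l j"
proof -
  have "{k. i < l k} = {..<card {k. i < l k}}"
  proof (rule down_set_eq_lessThan_card)
    have "{k. i < l k} \<subseteq> {k. l k \<noteq> 0}" by auto
    then show "finite {k. i < l k}"
      using assms by (auto simp: partitions_def intro: finite_subset)
    show "k' \<in> {k. i < l k}" if "k \<in> {k. i < l k}" "k' \<le> k" for k k'
      using that assms by (auto simp: partitions_def dest: antimonoD less_le_trans)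
  qed
  then show ?thesis by (auto simp: conj_part_def)
qed

lemma durfee_eqI:
  assumes "{..<d} \<times> {..<d} \<subseteq> diagram l" "(d, d) \<notin> diagram l"
  shows "durfee l = d"
  unfolding durfee_def
proof (rule Greatest_equality)
  show "{..<d} \<times> {..<d} \<subseteq> diagram l" by fact
  fix e assume "{..<e} \<times> {..<e} \<subseteq> diagram l"
  \<comment> \<open>A square of side greater than \<open>d\<close> would contain the corner
    \<open>(d, d)\<close>.\<close>
  with assms(2) show "e \<le> d" by (metis SigmaI lessThan_iff not_le subsetD)
qed

lemma durfee:
  assumes "l \<in> partitions"
  shows durfee_square: "{..<durfee l} \<times> {..<durfee l} \<subseteq> diagram l"
    and durfee_corner: "(durfee l, durfee l) \<notin> diagram l"
proof -
  \<comment> \<open>The first row bounds the side of every square in the diagram, so the maximum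
    behind \<open>GREATEST\<close> is attained.\<close>
  have le: "d \<le> l 0" if d: "{..<d} \<times> {..<d} \<subseteq> diagram l" for d
  proof (cases d)
    case (Suc e)
    then have "(0, e) \<in> {..<d} \<times> {..<d}" by simp
    with d have "(0, e) \<in> diagram l" by blast
    with Suc show ?thesis by simp
  qed simp
  show sq: "{..<durfee l} \<times> {..<durfee l} \<subseteq> diagram l"
    unfolding durfee_def by (rule GreatestI_nat[of _ 0 "l 0"]) (use le in auto)
  show "(durfee l, durfee l) \<notin> diagram l"
  proof
    assume "(durfee l, durfee l) \<in> diagram l"
    then have "{..<Suc (durfee l)} \<times> {..<Suc (durfee l)} \<subseteq> diagram l"
      using young_mono[OF young_diagram[OF assms]] by (auto simp del: mem_diagram)
    then have "Suc (durfee l) \<le> durfee l"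
      unfolding durfee_def using le by (intro Greatest_le_nat) auto
    then show False by simp
  qed
qed

section \<open>Decomposition into the Durfee square and two wings\<close>

abbreviation upper_cells :: "(nat \<Rightarrow> nat) \<Rightarrow> (nat \<times> nat) set" where
  "upper_cells l \<equiv> diagram (upper_wing l)"

abbreviation lower_cells :: "(nat \<Rightarrow> nat) \<Rightarrow> (nat \<times> nat) set" where
  "lower_cells l \<equiv> diagram (lower_wing l)"

lemma mem_upper_cells: "(i, j) \<in> upper_cells l \<longleftrightarrow> i < durfee l \<and> (i, durfee l + j) \<in> diagram l"
  by (auto simp: upper_wing_def)

lemma mem_lower_cells:
  assumes "l \<in> partitions"
  shows "(i, j) \<in> lower_cells l \<longleftrightarrow> i < durfee l \<and> (durfee l + j, i) \<in> diagram l"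
  using less_conj_part_iff[OF assms, of "durfee l + j" i] by (auto simp: lower_wing_def)

text \<open>Inverse of the decomposition: the Durfee square, \<open>X\<close> to its right and the
  transpose of \<open>Y\<close> below it.\<close>

definition assemble :: "nat \<Rightarrow> (nat \<times> nat) set \<Rightarrow> (nat \<times> nat) set \<Rightarrow> (nat \<times> nat) set" where
  "assemble d X Y = {..<d} \<times> {..<d} \<union> (\<lambda>(i, j). (i, d + j)) ` X \<union> (\<lambda>(i, j). (d + j, i)) ` Y"

lemma mem_assemble:
  "(i, j) \<in> assemble d X Y \<longleftrightarrow>
     i < d \<and> j < d \<or> d \<le> j \<and> (i, j - d) \<in> X \<or> d \<le> i \<and> (j, i - d) \<in> Y"
  by (force simp: assemble_def image_iff)

lemma diagram_eq_assemble:
  assumes l: "l \<in> partitions"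
  shows "diagram l = assemble (durfee l) (upper_cells l) (lower_cells l)"
proof (rule set_eqI, clarify)
  fix i j
  let ?d = "durfee l"
  \<comment> \<open>Since the corner \<open>(?d, ?d)\<close> is missing, no cell has both
    coordinates at least \<open>?d\<close>; hence the square, the part to its right and the part
    below it exhaust the diagram.\<close>
  have "i < ?d \<or> j < ?d" if "(i, j) \<in> diagram l"
    using that durfee_corner[OF l] young_mono[OF young_diagram[OF l] that, of ?d ?d]
    by (meson not_le)
  moreover have "(i, j) \<in> diagram l" if "i < ?d" "j < ?d"
    using that durfee_square[OF l] by blast
  ultimately show "(i, j) \<in> diagram l \<longleftrightarrow> (i, j) \<in> assemble ?d (upper_cells l) (lower_cells l)"
    unfolding mem_assemble mem_upper_cells mem_lower_cells[OF l]
    by (auto simp del: mem_diagram simp: not_less)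
qed

lemma young_upper_cells: "l \<in> partitions \<Longrightarrow> young (upper_cells l)"
proof (rule youngI)
  assume l: "l \<in> partitions"
  have "(\<lambda>(i, j). (i, durfee l + j)) ` upper_cells l \<subseteq> diagram l"
    using mem_upper_cells by auto
  then show "finite (upper_cells l)"
    by (rule inj_on_finite[rotated]) (auto simp: inj_on_def young_finite young_diagram l)
  show "(i, j) \<in> upper_cells l" if "(Suc i, j) \<in> upper_cells l" for i j
    using that young_mono[OF young_diagram[OF l], of "Suc i" "durfee l + j" i "durfee l + j"]
    unfolding mem_upper_cells by auto
  show "(i, j) \<in> upper_cells l" if "(i, Suc j) \<in> upper_cells l" for i j
    using that young_mono[OF young_diagram[OF l], of i "durfee l + Suc j" i "durfee l + j"]
    unfolding mem_upper_cells by auto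
qed

lemma young_lower_cells: "l \<in> partitions \<Longrightarrow> young (lower_cells l)"
proof (rule youngI)
  assume l: "l \<in> partitions"
  have "(\<lambda>(i, j). (durfee l + j, i)) ` lower_cells l \<subseteq> diagram l"
    using mem_lower_cells[OF l] by auto
  then show "finite (lower_cells l)"
    by (rule inj_on_finite[rotated]) (auto simp: inj_on_def young_finite young_diagram l)
  show "(i, j) \<in> lower_cells l" if "(Suc i, j) \<in> lower_cells l" for i j
    using that young_mono[OF young_diagram[OF l], of "durfee l + j" "Suc i" "durfee l + j" i]
    unfolding mem_lower_cells[OF l] by auto
  show "(i, j) \<in> lower_cells l" if "(i, Suc j) \<in> lower_cells l" for i j
    using that young_mono[OF young_diagram[OF l], of "durfee l + Suc j" i "durfee l + j" i]
    unfolding mem_lower_cells[OF l] by auto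
qed

lemma upper_cells_rows: "(i, j) \<in> upper_cells l \<Longrightarrow> i < durfee l"
  unfolding mem_upper_cells by blast

lemma lower_cells_rows: "(i, j) \<in> lower_cells l \<Longrightarrow> i < durfee l"
  by (auto simp: lower_wing_def split: if_splits)

text \<open>The pieces of \<open>assemble\<close> are disjoint: the upper wing has rows below
  \<open>d\<close> and columns from \<open>d\<close> on, the lower wing the reverse.\<close>

lemma psize_eq_wings:
  assumes l: "l \<in> partitions"
  shows "psize l = (durfee l)\<^sup>2 + card (upper_cells l) + card (lower_cells l)"
proof -
  let ?d = "durfee l"
  let ?U = "(\<lambda>(i, j). (i, ?d + j)) ` upper_cells l"
  let ?L = "(\<lambda>(i, j). (?d + j, i)) ` lower_cells l"
  have fin: "finite ?U" "finite ?L"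
    using young_finite[OF young_upper_cells[OF l]] young_finite[OF young_lower_cells[OF l]] by auto
  have "({..<?d} \<times> {..<?d}) \<inter> ?U = {}" by auto
  moreover have "({..<?d} \<times> {..<?d} \<union> ?U) \<inter> ?L = {}"
    using upper_cells_rows lower_cells_rows by fastforce
  ultimately have "card (assemble ?d (upper_cells l) (lower_cells l)) = ?d\<^sup>2 + card ?U + card ?L"
    unfolding assemble_def using fin by (simp add: card_Un_disjoint card_cartesian_product power2_eq_square)
  moreover have "card ?U = card (upper_cells l)" "card ?L = card (lower_cells l)"
    by (rule card_image, auto simp: inj_on_def)+
  ultimately show ?thesis using psize_eq_card[OF l] diagram_eq_assemble[OF l] by simp
qed

text \<open>Surjectivity of the decomposition, which supplies the partition whose wings a flip
  prescribes.\<close>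

lemma partition_with_wings:
  assumes X: "young X" "X \<subseteq> {..<d} \<times> UNIV" and Y: "young Y" "Y \<subseteq> {..<d} \<times> UNIV"
  obtains m where "m \<in> partitions" "durfee m = d" "upper_cells m = X" "lower_cells m = Y"
proof -
  have Xd: "i < d" if "(i, j) \<in> X" for i j using that X(2) by auto
  have Yd: "i < d" if "(i, j) \<in> Y" for i j using that Y(2) by auto
  have "young (assemble d X Y)"
  proof (rule youngI)
    show "finite (assemble d X Y)"
      using young_finite[OF X(1)] young_finite[OF Y(1)] by (simp add: assemble_def)
    show "(i, j) \<in> assemble d X Y" if "(Suc i, j) \<in> assemble d X Y" for i j
    proof -
      have "(j, i - d) \<in> Y" if "(j, Suc i - d) \<in> Y" by (rule young_mono[OF Y(1) that]) auto
      moreover have "(i, j - d) \<in> X" if "(Suc i, j - d) \<in> X" by (rule young_mono[OF X(1) that]) auto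
      \<comment> \<open>If \<open>Suc i = d\<close>, a cell of the lower wing has column
        \<open>j < d\<close> by \<open>Yd\<close>, so the cell above it lies in the square.
        Otherwise the step stays within its piece.\<close>
      ultimately show ?thesis using that Xd Yd unfolding mem_assemble
        by (metis Suc_lessD not_less)
    qed
    show "(i, j) \<in> assemble d X Y" if "(i, Suc j) \<in> assemble d X Y" for i j
    proof -
      have "(i, j - d) \<in> X" if "(i, Suc j - d) \<in> X" by (rule young_mono[OF X(1) that]) auto
      moreover have "(j, i - d) \<in> Y" if "(Suc j, i - d) \<in> Y" by (rule young_mono[OF Y(1) that]) auto
      ultimately show ?thesis using that Xd Yd unfolding mem_assemble
        by (metis Suc_lessD not_less)
    qed
  qed
  then obtain m where m: "m \<in> partitions" "diagram m = assemble d X Y"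
    by (rule young_eq_diagram)
  \<comment> \<open>The corner \<open>(d, d)\<close> could only come from row \<open>d\<close> of
    \<open>X\<close> or \<open>Y\<close>, and their rows stop before \<open>d\<close>.\<close>
  have d: "durfee m = d"
    by (rule durfee_eqI; unfold m(2)) (use Xd Yd in \<open>auto simp: mem_assemble\<close>)
  moreover have "upper_cells m = X"
  proof (rule set_eqI, clarify)
    fix i j show "(i, j) \<in> upper_cells m \<longleftrightarrow> (i, j) \<in> X"
      unfolding mem_upper_cells m(2) d mem_assemble using Xd Yd by auto
  qed
  moreover have "lower_cells m = Y"
  proof (rule set_eqI, clarify)
    fix i j show "(i, j) \<in> lower_cells m \<longleftrightarrow> (i, j) \<in> Y"
      unfolding mem_lower_cells[OF m(1)] m(2) d mem_assemble using Xd Yd by auto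
  qed
  ultimately show ?thesis using that m(1) by blast
qed

text \<open>Injectivity of the decomposition: \<open>assemble\<close> rebuilds the diagram from the
  Durfee size and the wings.\<close>

lemma partition_eq_iff_wings:
  assumes "l \<in> partitions" "m \<in> partitions" "durfee l = durfee m"
    "upper_cells l = upper_cells m" "lower_cells l = lower_cells m"
  shows "l = m"
  using assms diagram_eq_assemble diagram_eq_iff by metis

lemma P_plus_iff:
  assumes l: "l \<in> partitions"
  shows "l \<in> P_plus \<longleftrightarrow> lower_cells l \<subseteq> upper_cells l"
proof -
  \<comment> \<open>This keeps the subtractions in the wings from truncating, so that a successive
    rank is the difference of two wing rows.\<close>
  have "durfee l \<le> l i" "durfee l \<le> conj_part l i" if i: "i < durfee l" for i
  proof -
    have "(i, durfee l - 1) \<in> {..<durfee l} \<times> {..<durfee l}"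
      "(durfee l - 1, i) \<in> {..<durfee l} \<times> {..<durfee l}" using i by auto
    then have "(i, durfee l - 1) \<in> diagram l" "(durfee l - 1, i) \<in> diagram l"
      using durfee_square[OF l] by blast+
    then have "durfee l - 1 < l i" "durfee l - 1 < conj_part l i"
      using less_conj_part_iff[OF l] by auto
    then show "durfee l \<le> l i" "durfee l \<le> conj_part l i" by auto
  qed
  then have "0 \<le> succ_rank l i \<longleftrightarrow> lower_wing l i \<le> upper_wing l i" if "i < durfee l" for i
    using that by (simp add: succ_rank_def lower_wing_def upper_wing_def le_diff_iff)
  moreover have "lower_cells l \<subseteq> upper_cells l \<longleftrightarrow> (\<forall>i. lower_wing l i \<le> upper_wing l i)"
  proof
    assume sub: "lower_cells l \<subseteq> upper_cells l"
    show "\<forall>i. lower_wing l i \<le> upper_wing l i"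
    proof (rule allI, rule ccontr)
      fix i assume "\<not> lower_wing l i \<le> upper_wing l i"
      \<comment> \<open>The witness is the first cell beyond row \<open>i\<close> of the upper
        wing.\<close>
      then have "(i, upper_wing l i) \<in> lower_cells l" by simp
      with sub have "(i, upper_wing l i) \<in> upper_cells l" by blast
      then show False by simp
    qed
  qed (auto simp: diagram_def dest: less_le_trans)
  moreover have "lower_wing l i \<le> upper_wing l i" if "\<not> i < durfee l" for i
    using that by (simp add: lower_wing_def)
  ultimately show ?thesis using l by (auto simp: P_plus_def)
qed

section \<open>Flipping diagonal blocks\<close>

text \<open>Composed flips act on cells by symmetric difference; disjointness lifts this to sets of
  blocks.\<close>

lemma Union_sym_diff_disjoint:
  assumes "disjoint P" "\<B> \<subseteq> P" "\<C> \<subseteq> P"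
  shows "\<Union>(sym_diff \<B> \<C>) = sym_diff (\<Union>\<B>) (\<Union>\<C>)"
proof -
  have "B = C" if "B \<in> \<B>" "C \<in> \<C>" "x \<in> B" "x \<in> C" for B C x
    using that assms by (auto simp: disjoint_def)
  then show ?thesis by blast
qed

text \<open>Blocks are nonempty and disjoint, so each is recovered from any of its points. Different
  choices of blocks therefore move different cells.\<close>

lemma Union_inj_on_partition:
  assumes "partition_on A P"
  shows "inj_on Union (Pow P)"
proof (rule inj_onI)
  fix \<B> \<C> assume *: "\<B> \<in> Pow P" "\<C> \<in> Pow P" "\<Union>\<B> = \<Union>\<C>"
  have "\<B>' \<subseteq> \<C>'" if "\<B>' \<subseteq> P" "\<C>' \<subseteq> P" "\<Union>\<B>' = \<Union>\<C>'" for \<B>' \<C>'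
  proof
    fix B assume B: "B \<in> \<B>'"
    with that(1) have "B \<noteq> {}" using partition_onD3[OF assms] by auto
    then obtain x where x: "x \<in> B" by blast
    with B that(3) obtain C where "C \<in> \<C>'" "x \<in> C" by blast
    moreover have "B = C"
      using calculation x B that(1,2) partition_onD2[OF assms] disjointD[of P B C] by blast
    ultimately show "B \<in> \<C>'" by simp
  qed
  with * show "\<B> = \<C>" by (metis PowD subset_antisym)
qed

section \<open>Edge components\<close>

lemma edge_adjacent_sym: "edge_adjacent c c' \<Longrightarrow> edge_adjacent c' c"
  by (auto simp: edge_adjacent_def)

text \<open>Adjacency is symmetric, so any two cells of a component are joined by a path, along
  which the property is carried.\<close>

lemma edge_components_invariant:
  assumes B: "B \<in> edge_components S"
    and step: "\<And>c c'. c \<in> S \<Longrightarrow> c' \<in> S \<Longrightarrow> edge_adjacent c c' \<Longrightarrow> P c \<Longrightarrow> P c'"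
    and "c \<in> B" "P c" "c' \<in> B"
  shows "P c'"
proof -
  let ?r = "{(c, c'). c \<in> S \<and> c' \<in> S \<and> edge_adjacent c c'}"
  have "sym ?r" by (auto intro: symI edge_adjacent_sym)
  then have sym: "sym (?r\<^sup>*)" by (rule sym_rtrancl)
  from B obtain x where x: "B = ?r\<^sup>* `` {x}"
    by (auto simp: edge_components_def elim: quotientE)
  with assms(3,5) have "(x, c) \<in> ?r\<^sup>*" "(x, c') \<in> ?r\<^sup>*" by auto
  with sym have "(c, c') \<in> ?r\<^sup>*" by (meson rtrancl_trans symD)
  then show ?thesis by (induction rule: rtrancl_induct) (use \<open>P c\<close> step in auto)
qed

text \<open>The reflexive closure relates cells outside \<open>S\<close> to themselves and so is no
  relation on \<open>S\<close>. Restricting it to \<open>S\<close> leaves the classes unchanged,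
  because paths that start in \<open>S\<close> stay in \<open>S\<close>.\<close>

lemma partition_on_edge_components: "partition_on S (edge_components S)"
proof -
  define r where "r = {(c, c'). c \<in> S \<and> c' \<in> S \<and> edge_adjacent c c'}"
  have sym: "sym (r\<^sup>*)" unfolding r_def by (intro sym_rtrancl symI) (auto intro: edge_adjacent_sym)
  have stay: "c' \<in> S" if "(c, c') \<in> r\<^sup>*" "c \<in> S" for c c'
    using that by (induction rule: rtrancl_induct) (auto simp: r_def)
  have "equiv S (r\<^sup>* \<inter> S \<times> S)"
  proof (rule equivI)
    show "sym (r\<^sup>* \<inter> S \<times> S)" using sym by (auto simp: sym_def)
    show "trans (r\<^sup>* \<inter> S \<times> S)" by (auto intro!: transI intro: rtrancl_trans)
  qed (auto simp: refl_on_def)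
  then have "partition_on S (S // (r\<^sup>* \<inter> S \<times> S))" by (rule partition_on_quotient)
  moreover have "S // (r\<^sup>* \<inter> S \<times> S) = S // r\<^sup>*"
    unfolding quotient_def using stay by auto
  ultimately show ?thesis by (simp add: edge_components_def r_def)
qed

lemma edge_components_closed:
  assumes B: "B \<in> edge_components S" and c: "c \<in> B" "c' \<in> S" "edge_adjacent c c'"
  shows "c' \<in> B"
proof -
  have "c \<in> S" using B c(1) partition_onD1[OF partition_on_edge_components, of S] by blast
  moreover obtain x where "B = {(c, c'). c \<in> S \<and> c' \<in> S \<and> edge_adjacent c c'}\<^sup>* `` {x}"
    using B by (auto simp: edge_components_def elim: quotientE)
  ultimately show ?thesis using c by (auto intro: rtrancl_into_rtrancl)
qed

lemma edge_adjacent_Suc: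
  "edge_adjacent (Suc i, j) (i, j)" "edge_adjacent (i, Suc j) (i, j)"
  by (simp_all add: edge_adjacent_def)

lemma edge_adjacent_cases:
  assumes "edge_adjacent c c'"
  obtains i j where "c = (i, j)" "c' = (Suc i, j)" | i j where "c = (i, j)" "c' = (i, Suc j)"
    | i j where "c = (Suc i, j)" "c' = (i, j)" | i j where "c = (i, Suc j)" "c' = (i, j)"
  using assms by (cases c; cases c') (auto simp: edge_adjacent_def)

lemma young_mono_Suc:
  assumes "young X"
  shows "(Suc i, j) \<in> X \<Longrightarrow> (i, j) \<in> X" "(i, Suc j) \<in> X \<Longrightarrow> (i, j) \<in> X"
  using young_mono[OF assms] by (meson le_SucI order_refl)+

text \<open>Of two adjacent cells, the one nearer the origin lies in each diagram that contains the
  other. If both lie in exactly one diagram, it is the same one, so the side is constant along a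
  path.\<close>

lemma block_one_sided:
  assumes X: "young X" and Y: "young Y" and B: "B \<in> edge_components (sym_diff X Y)"
  shows "B \<subseteq> X - Y \<or> B \<subseteq> Y - X"
proof (rule ccontr)
  assume "\<not> (B \<subseteq> X - Y \<or> B \<subseteq> Y - X)"
  moreover have "B \<subseteq> sym_diff X Y"
    using partition_onD1[OF partition_on_edge_components, of "sym_diff X Y"] B by blast
  ultimately obtain c c' where c: "c \<in> B" "c \<in> X - Y" "c' \<in> B" "c' \<notin> X" by blast
  have "c' \<in> X"
  proof (rule edge_components_invariant[OF B, of "\<lambda>c. c \<in> X"])
    fix a b assume "a \<in> sym_diff X Y" "b \<in> sym_diff X Y" "edge_adjacent a b" "a \<in> X"
    then show "b \<in> X"
      by (elim edge_adjacent_cases) (use young_mono_Suc[OF X] young_mono_Suc[OF Y] in blast)+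
  qed (use c in auto)
  with c show False by simp
qed

text \<open>By one-sidedness every block either leaves \<open>X\<close> entirely or enters it
  entirely.\<close>

lemma move_blocks_eq_sym_diff:
  assumes "young X" "young Y" "\<B> \<subseteq> edge_components (sym_diff X Y)"
  shows "move_blocks \<B> X Y = sym_diff X (\<Union>\<B>)"
  using assms block_one_sided[OF assms(1,2)] unfolding move_blocks_def by blast

text \<open>A cell of \<open>X \<union> Y\<close> outside \<open>X \<inter> Y\<close> lies in the same block as any
  neighbour of it that is also outside, so it is moved together with that neighbour.\<close>

lemma young_move_blocks:
  assumes X: "young X" and Y: "young Y" and \<B>: "\<B> \<subseteq> edge_components (sym_diff X Y)"
  shows "young (sym_diff X (\<Union>\<B>))"
proof -
  let ?S = "sym_diff X Y"
  have sub: "\<Union>\<B> \<subseteq> ?S"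
    using partition_onD1[OF partition_on_edge_components, of ?S] \<B> by blast
  have same: "c \<in> \<Union>\<B> \<longleftrightarrow> c' \<in> \<Union>\<B>" if adj: "c \<in> ?S" "c' \<in> ?S" "edge_adjacent c c'" for c c'
  proof -
    have "b \<in> \<Union>\<B>" if "a \<in> \<Union>\<B>" "b \<in> ?S" "edge_adjacent a b" for a b
      using that \<B> edge_components_closed by blast
    from this[of c c'] this[of c' c] adj show ?thesis using edge_adjacent_sym by blast
  qed
  show ?thesis
  proof (rule youngI)
    show "finite (sym_diff X (\<Union>\<B>))"
      using young_finite[OF X] young_finite[OF Y] sub
      by (auto intro: finite_subset[of _ "X \<union> Y"])
    \<comment> \<open>Here \<open>a\<close>, and hence \<open>b\<close>, lies in \<open>X\<close> or
      \<open>Y\<close>. If \<open>b\<close> lies in both, it is in no block and stays. Otherwise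
      \<open>a\<close> lies in the same single diagram as \<open>b\<close>, and \<open>same\<close>
      applies.\<close>
    have down: "b \<in> sym_diff X (\<Union>\<B>)"
      if "a \<in> sym_diff X (\<Union>\<B>)" "a \<in> X \<Longrightarrow> b \<in> X" "a \<in> Y \<Longrightarrow> b \<in> Y" "edge_adjacent a b" for a b
      using that same[of a b] sub by blast
    show "(i, j) \<in> sym_diff X (\<Union>\<B>)" if "(Suc i, j) \<in> sym_diff X (\<Union>\<B>)" for i j
      by (rule down[OF that]) (erule young_mono_Suc[OF X], erule young_mono_Suc[OF Y], rule edge_adjacent_Suc)
    show "(i, j) \<in> sym_diff X (\<Union>\<B>)" if "(i, Suc j) \<in> sym_diff X (\<Union>\<B>)" for i j
      by (rule down[OF that]) (erule young_mono_Suc[OF X], erule young_mono_Suc[OF Y], rule edge_adjacent_Suc)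
  qed
qed

lemma diagonal_blocks_eq: "diagonal_blocks l = edge_components (sym_diff (upper_cells l) (lower_cells l))"
proof -
  \<comment> \<open>Rowwise maximum and minimum correspond to union and intersection of the cell
    sets.\<close>
  have "diagram (outer_shape l) - diagram (inner_shape l) = sym_diff (upper_cells l) (lower_cells l)"
    by (auto simp: outer_shape_def inner_shape_def diagram_def)
  then show ?thesis by (simp add: diagonal_blocks_def)
qed

lemma partition_on_diagonal_blocks:
  "partition_on (sym_diff (upper_cells l) (lower_cells l)) (diagonal_blocks l)"
  unfolding diagonal_blocks_eq by (rule partition_on_edge_components)

lemma Union_diagonal_blocks:
  "\<Union>(diagonal_blocks l) = sym_diff (upper_cells l) (lower_cells l)"
  using partition_onD1[OF partition_on_diagonal_blocks] by simp

lemma finite_diagonal_blocks: "l \<in> partitions \<Longrightarrow> finite (diagonal_blocks l)"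
  by (rule finite_elements[OF _ partition_on_diagonal_blocks])
    (simp add: young_finite young_upper_cells young_lower_cells)

lemma is_flip_iff:
  assumes l: "l \<in> partitions" and \<B>: "\<B> \<subseteq> diagonal_blocks l"
  shows "is_flip \<B> l m \<longleftrightarrow> m \<in> partitions \<and> durfee m = durfee l \<and>
    upper_cells m = sym_diff (upper_cells l) (\<Union>\<B>) \<and>
    lower_cells m = sym_diff (lower_cells l) (\<Union>\<B>)"
proof -
  note y = young_upper_cells[OF l] young_lower_cells[OF l]
  have \<B>': "\<B> \<subseteq> edge_components (sym_diff (lower_cells l) (upper_cells l))"
    using \<B> unfolding diagonal_blocks_eq by (simp add: Un_commute)
  show ?thesis
    unfolding is_flip_def using move_blocks_eq_sym_diff[OF y \<B>[unfolded diagonal_blocks_eq]]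
      move_blocks_eq_sym_diff[OF y(2,1) \<B>'] by simp
qed

lemma flip_unique: "is_flip \<B> l m \<Longrightarrow> is_flip \<B> l m' \<Longrightarrow> m = m'"
  unfolding is_flip_def by (intro partition_eq_iff_wings) auto

text \<open>Both altered wings are again Young diagrams and occupy no new rows, so they belong to a
  partition with the same Durfee size.\<close>

lemma flip_exists:
  assumes l: "l \<in> partitions" and \<B>: "\<B> \<subseteq> diagonal_blocks l"
  obtains m where "is_flip \<B> l m"
proof -
  note y = young_upper_cells[OF l] young_lower_cells[OF l]
  have \<B>': "\<B> \<subseteq> edge_components (sym_diff (lower_cells l) (upper_cells l))"
    using \<B> unfolding diagonal_blocks_eq by (simp add: Un_commute)
  have "\<Union>\<B> \<subseteq> sym_diff (upper_cells l) (lower_cells l)"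
    using \<B> Union_diagonal_blocks by blast
  then have rows: "sym_diff (upper_cells l) (\<Union>\<B>) \<subseteq> {..<durfee l} \<times> UNIV"
    "sym_diff (lower_cells l) (\<Union>\<B>) \<subseteq> {..<durfee l} \<times> UNIV"
    using upper_cells_rows[of _ _ l] lower_cells_rows[of _ _ l] by auto
  obtain m where "m \<in> partitions" "durfee m = durfee l"
    "upper_cells m = sym_diff (upper_cells l) (\<Union>\<B>)"
    "lower_cells m = sym_diff (lower_cells l) (\<Union>\<B>)"
    using partition_with_wings[OF young_move_blocks[OF y \<B>[unfolded diagonal_blocks_eq]] rows(1)
          young_move_blocks[OF y(2,1) \<B>'] rows(2)] .
  then have "is_flip \<B> l m" using is_flip_iff[OF l \<B>] by simp
  then show ?thesis by (rule that)
qed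

text \<open>Both wings change by the same set of cells, which cancels in their symmetric
  difference.\<close>

lemma flip_diagonal_blocks:
  assumes "l \<in> partitions" "\<B> \<subseteq> diagonal_blocks l" "is_flip \<B> l m"
  shows "diagonal_blocks m = diagonal_blocks l"
proof -
  have "upper_cells m = sym_diff (upper_cells l) (\<Union>\<B>)"
    "lower_cells m = sym_diff (lower_cells l) (\<Union>\<B>)"
    using assms is_flip_iff by auto
  then have "sym_diff (upper_cells m) (lower_cells m) = sym_diff (upper_cells l) (lower_cells l)"
    by blast
  then show ?thesis unfolding diagonal_blocks_eq by simp
qed

text \<open>Associativity of symmetric difference, applied to each wing.\<close>

lemma flip_trans:
  assumes l: "l \<in> partitions" and \<B>: "\<B> \<subseteq> diagonal_blocks l" "is_flip \<B> l m"
    and \<C>: "\<C> \<subseteq> diagonal_blocks l" "is_flip \<C> m n"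
  shows "is_flip (sym_diff \<B> \<C>) l n"
proof -
  have m: "m \<in> partitions" "diagonal_blocks m = diagonal_blocks l"
    using \<B> flip_diagonal_blocks[OF l] by (auto simp: is_flip_def)
  have "sym_diff \<B> \<C> \<subseteq> diagonal_blocks l" using \<B> \<C> by blast
  moreover have "\<Union>(sym_diff \<B> \<C>) = sym_diff (\<Union>\<B>) (\<Union>\<C>)"
    using Union_sym_diff_disjoint[OF partition_onD2[OF partition_on_diagonal_blocks]] \<B>(1) \<C>(1) .
  moreover have "durfee m = durfee l" "upper_cells m = sym_diff (upper_cells l) (\<Union>\<B>)"
    "lower_cells m = sym_diff (lower_cells l) (\<Union>\<B>)"
    using \<B>(2) unfolding is_flip_iff[OF l \<B>(1)] by blast+
  moreover have "n \<in> partitions" "durfee n = durfee m"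
    "upper_cells n = sym_diff (upper_cells m) (\<Union>\<C>)"
    "lower_cells n = sym_diff (lower_cells m) (\<Union>\<C>)"
    using \<C>(2) unfolding is_flip_iff[OF m(1) \<C>(1)[folded m(2)]] by blast+
  moreover have "sym_diff (sym_diff A (\<Union>\<B>)) (\<Union>\<C>) = sym_diff A (sym_diff (\<Union>\<B>) (\<Union>\<C>))" for A
    by blast
  ultimately show ?thesis by (simp only: is_flip_iff[OF l])
qed

lemma flip_sym:
  assumes "l \<in> partitions" "\<B> \<subseteq> diagonal_blocks l" "is_flip \<B> l m"
  shows "is_flip \<B> m l"
proof -
  have m: "m \<in> partitions" "\<B> \<subseteq> diagonal_blocks m"
    using assms flip_diagonal_blocks by (auto simp: is_flip_def)
  show ?thesis unfolding is_flip_iff[OF m] using assms is_flip_iff[OF assms(1,2), of m] by auto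
qed

lemma flip_refl: "l \<in> partitions \<Longrightarrow> is_flip {} l l"
  by (simp add: is_flip_def move_blocks_def)

section \<open>Flip classes and their invariants\<close>

lemma self_in_flip_class: "l \<in> partitions \<Longrightarrow> l \<in> flip_class l"
  using flip_refl by (auto simp: flip_class_def)

lemma flip_class_subset: "flip_class l \<subseteq> partitions"
  by (auto simp: flip_class_def is_flip_def)

lemma flip_class_eq:
  assumes l: "l \<in> partitions" and m: "m \<in> flip_class l"
  shows "flip_class m = flip_class l" "diagonal_blocks m = diagonal_blocks l"
proof -
  \<comment> \<open>Stated for an arbitrary pair because the inclusion is used in both directions,
    for \<open>l\<close>, \<open>m\<close> and for \<open>m\<close>, \<open>l\<close>.\<close>
  have sub: "flip_class m' \<subseteq> flip_class l'" "l' \<in> flip_class m'" "diagonal_blocks m' = diagonal_blocks l'"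
    if l': "l' \<in> partitions" and m': "m' \<in> flip_class l'" for l' m'
  proof -
    obtain \<B> where \<B>: "\<B> \<subseteq> diagonal_blocks l'" "is_flip \<B> l' m'"
      using m' by (auto simp: flip_class_def)
    show eq: "diagonal_blocks m' = diagonal_blocks l'" using flip_diagonal_blocks[OF l' \<B>] .
    show "l' \<in> flip_class m'" using flip_sym[OF l' \<B>] \<B>(1) eq by (auto simp: flip_class_def)
    show "flip_class m' \<subseteq> flip_class l'"
    proof
      fix n assume "n \<in> flip_class m'"
      then obtain \<C> where "\<C> \<subseteq> diagonal_blocks l'" "is_flip \<C> m' n"
        using eq by (auto simp: flip_class_def)
      then have "is_flip (sym_diff \<B> \<C>) l' n" "sym_diff \<B> \<C> \<subseteq> diagonal_blocks l'"
        using flip_trans[OF l' \<B>] \<B>(1) by auto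
      then show "n \<in> flip_class l'" unfolding flip_class_def by blast
    qed
  qed
  have "m \<in> partitions" using m flip_class_subset by blast
  with sub[OF l m] sub(1)[of m l] show "flip_class m = flip_class l" 
    "diagonal_blocks m = diagonal_blocks l" by auto
qed

lemma partition_on_flip_classes: "partition_on partitions flip_classes"
proof (rule partition_onI)
  show "\<Union>flip_classes = partitions"
    using flip_class_subset self_in_flip_class by (fastforce simp: flip_classes_def)
  show "disjnt p q" if "p \<in> flip_classes" "q \<in> flip_classes" "p \<noteq> q" for p q
    using that flip_class_eq(1) unfolding flip_classes_def disjnt_iff by (metis imageE)
  show "{} \<notin> flip_classes"
    using self_in_flip_class by (auto simp: flip_classes_def)
qed

lemma boolean_flip_class:
  assumes l: "l \<in> partitions"
  shows "boolean_class (flip_class l)"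
  unfolding boolean_class_def
proof (intro ballI allI impI)
  fix m \<B> assume m: "m \<in> flip_class l" and \<B>: "\<B> \<subseteq> diagonal_blocks m"
  have mp: "m \<in> partitions" using m flip_class_subset by blast
  obtain n where n: "is_flip \<B> m n" using flip_exists[OF mp \<B>] .
  then have "n \<in> flip_class m" using \<B> by (auto simp: flip_class_def)
  then have "n \<in> flip_class l" using flip_class_eq[OF l m] by simp
  with n show "\<exists>!n. n \<in> flip_class l \<and> is_flip \<B> m n" using flip_unique by blast
qed

text \<open>Flipping \<open>l\<close> is a bijection from the sets of diagonal blocks of
  \<open>l\<close> onto its class.\<close>

lemma card_flip_class:
  assumes l: "l \<in> partitions"
  shows "card (flip_class l) = 2 ^ kappa l"
proof -
  have "\<forall>\<B> \<in> Pow (diagonal_blocks l). \<exists>m. is_flip \<B> l m"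
    using flip_exists[OF l] by (metis PowD)
  then obtain f where f: "is_flip \<B> l (f \<B>)" if "\<B> \<subseteq> diagonal_blocks l" for \<B>
    by (metis PowI)
  have "flip_class l = f ` Pow (diagonal_blocks l)"
    using f flip_unique unfolding flip_class_def by blast
  moreover have "inj_on f (Pow (diagonal_blocks l))"
  proof (rule inj_onI)
    fix \<B> \<C> assume *: "\<B> \<in> Pow (diagonal_blocks l)" "\<C> \<in> Pow (diagonal_blocks l)" "f \<B> = f \<C>"
    have "sym_diff (upper_cells l) (\<Union>\<B>) = sym_diff (upper_cells l) (\<Union>\<C>)"
      using * f is_flip_iff[OF l] by (metis PowD)
    \<comment> \<open>Symmetric difference with a fixed set is injective.\<close>
    then have "\<Union>\<B> = \<Union>\<C>" by blast
    with * show "\<B> = \<C>"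
      using inj_onD[OF Union_inj_on_partition[OF partition_on_diagonal_blocks]] by blast
  qed
  ultimately show ?thesis
    by (simp add: card_image card_Pow kappa_def finite_diagonal_blocks l)
qed

text \<open>Inclusion-exclusion expresses the size through data that flips preserve.\<close>

lemma psize_eq_card_Un_Int:
  assumes "l \<in> partitions"
  shows "psize l = (durfee l)\<^sup>2 + card (upper_cells l \<union> lower_cells l) + card (upper_cells l \<inter> lower_cells l)"
  using psize_eq_wings[OF assms]
    card_Un_Int[OF young_finite[OF young_upper_cells] young_finite[OF young_lower_cells], OF assms assms]
  by simp

lemma flip_class_cells:
  assumes l: "l \<in> partitions" and m: "m \<in> flip_class l"
  shows "durfee m = durfee l"
    and "upper_cells m \<union> lower_cells m = upper_cells l \<union> lower_cells l"
    and "upper_cells m \<inter> lower_cells m = upper_cells l \<inter> lower_cells l"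
proof -
  obtain \<B> where \<B>: "\<B> \<subseteq> diagonal_blocks l" "is_flip \<B> l m"
    using m by (auto simp: flip_class_def)
  have sub: "\<Union>\<B> \<subseteq> sym_diff (upper_cells l) (lower_cells l)"
    using \<B>(1) Union_diagonal_blocks by blast
  have eq: "upper_cells m = sym_diff (upper_cells l) (\<Union>\<B>)"
    "lower_cells m = sym_diff (lower_cells l) (\<Union>\<B>)" "durfee m = durfee l"
    using \<B> is_flip_iff[OF l] by auto
  from eq(3) show "durfee m = durfee l" .
  \<comment> \<open>A moved cell lies in exactly one wing before the flip and in exactly the other
    one after it.\<close>
  show "upper_cells m \<union> lower_cells m = upper_cells l \<union> lower_cells l"
    "upper_cells m \<inter> lower_cells m = upper_cells l \<inter> lower_cells l"
    unfolding eq(1,2) using sub by blast+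
qed

lemma psize_flip_class:
  assumes "l \<in> partitions" "m \<in> flip_class l"
  shows "psize m = psize l"
proof -
  have "m \<in> partitions" using assms flip_class_subset by blast
  then show ?thesis using psize_eq_card_Un_Int flip_class_cells[OF assms] assms(1) by simp
qed

text \<open>Flipping precisely the blocks that lie in the lower wing yields nested wings. Uniqueness
  holds because nested wings are the union and the intersection of the two, and both are constant on
  the class.\<close>

lemma flip_class_P_plus:
  assumes l: "l \<in> partitions"
  shows "\<exists>!m. m \<in> flip_class l \<and> m \<in> P_plus"
proof (rule ex_ex1I)
  define \<B> where "\<B> = {B \<in> diagonal_blocks l. B \<subseteq> lower_cells l - upper_cells l}"
  have \<B>: "\<B> \<subseteq> diagonal_blocks l" by (auto simp: \<B>_def)
  have "\<Union>\<B> = lower_cells l - upper_cells l"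
  proof -
    have "x \<in> \<Union>\<B>" if x: "x \<in> lower_cells l - upper_cells l" for x
    proof -
      have "x \<in> \<Union>(diagonal_blocks l)" using x Union_diagonal_blocks by blast
      then obtain B where B: "B \<in> diagonal_blocks l" "x \<in> B" by blast
      \<comment> \<open>The block of \<open>x\<close> meets the lower side, hence lies on it
        entirely.\<close>
      with x block_one_sided[OF young_upper_cells[OF l] young_lower_cells[OF l]]
      have "B \<in> \<B>" unfolding \<B>_def diagonal_blocks_eq by blast
      with B show ?thesis by blast
    qed
    then show ?thesis by (auto simp: \<B>_def)
  qed
  moreover obtain m where m: "is_flip \<B> l m" using flip_exists[OF l \<B>] .
  ultimately have "lower_cells m \<subseteq> upper_cells m" "m \<in> partitions"
    using is_flip_iff[OF l \<B>] by auto
  with m \<B> show "\<exists>m. m \<in> flip_class l \<and> m \<in> P_plus"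
    using P_plus_iff by (auto simp: flip_class_def)
next
  fix m n assume m: "m \<in> flip_class l \<and> m \<in> P_plus" and n: "n \<in> flip_class l \<and> n \<in> P_plus"
  then have p: "m \<in> partitions" "n \<in> partitions" using flip_class_subset by blast+
  have "lower_cells m \<subseteq> upper_cells m" "lower_cells n \<subseteq> upper_cells n"
    using m n p P_plus_iff by auto
  moreover note flip_class_cells[OF l, of m] flip_class_cells[OF l, of n]
  ultimately show "m = n" using m n p by (intro partition_eq_iff_wings) (auto simp: Un_absorb2 Int_absorb1)
qed

section \<open>The generating function\<close>

text \<open>The entry \<open>l 0\<close> is the largest part, so bounding it bounds all
  parts.\<close>

definition bounded_partitions :: "nat \<Rightarrow> nat \<Rightarrow> (nat \<Rightarrow> nat) set" where
  "bounded_partitions N n = {l \<in> partitions. l 0 \<le> N \<and> psize l = n}"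

lemma partition_part_le_psize: "l \<in> partitions \<Longrightarrow> l i \<le> psize l"
  unfolding psize_def by (cases "l i = 0") (auto simp: partitions_def intro!: member_le_sum)

text \<open>A nonzero part at index \<open>i\<close> forces \<open>i + 1\<close> cells in the first
  column.\<close>

lemma partition_support_le_psize:
  assumes l: "l \<in> partitions" and "l i \<noteq> 0"
  shows "i < psize l"
proof -
  have "l k \<noteq> 0" if "k \<le> i" for k
    using that assms antimonoD[of l k i] by (auto simp: partitions_def)
  then have "(\<lambda>k. (k, 0)) ` {..i} \<subseteq> diagram l" by auto
  then have "card ((\<lambda>k. (k, 0 :: nat)) ` {..i}) \<le> psize l"
    unfolding psize_eq_card[OF l] by (intro card_mono young_finite young_diagram l)
  then show ?thesis by (simp add: card_image inj_on_def)
qed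

lemma finite_partitions_psize: "finite {l \<in> partitions. psize l = n}"
proof -
  have "{l \<in> partitions. psize l = n} \<subseteq> {l. \<forall>i. (i \<in> {..<n} \<longrightarrow> l i \<in> {..n}) \<and> (i \<notin> {..<n} \<longrightarrow> l i = 0)}"
    using partition_part_le_psize partition_support_le_psize by fastforce
  then show ?thesis by (rule finite_subset) (rule finite_set_of_finite_funs, auto)
qed

lemma finite_bounded_partitions: "finite (bounded_partitions N n)"
  by (rule finite_subset[OF _ finite_partitions_psize[of n]]) (auto simp: bounded_partitions_def)

lemma bounded_partitions_0: "bounded_partitions 0 n = (if n = 0 then {\<lambda>i. 0} else {})"
proof -
  have "l \<in> partitions \<and> l 0 \<le> 0 \<longleftrightarrow> l = (\<lambda>i. 0)" for l
  proof
    assume l: "l \<in> partitions \<and> l 0 \<le> 0"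
    have "l i = 0" for i
      using l antimonoD[of l 0 i] by (simp add: partitions_def)
    then show "l = (\<lambda>i. 0)" by blast
  qed (simp add: partitions_def antimono_def)
  then have "bounded_partitions 0 n = {l. l = (\<lambda>i. 0) \<and> psize l = n}"
    unfolding bounded_partitions_def by blast
  moreover have "psize (\<lambda>i. 0) = 0" by (simp add: psize_def)
  ultimately show ?thesis by auto
qed

lemma support_case_nat: "{i. case_nat k l i \<noteq> 0} \<subseteq> insert 0 (Suc ` {i. l i \<noteq> 0})"
proof
  fix i assume "i \<in> {i. case_nat k l i \<noteq> 0}"
  then show "i \<in> insert 0 (Suc ` {i. l i \<noteq> 0})" by (cases i) auto
qed

text \<open>Here \<open>case_nat k l\<close> is \<open>l\<close> with the part \<open>k\<close> put
  in front, the inverse of removing a largest part.\<close>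

lemma case_nat_partition:
  "case_nat k l \<in> partitions \<longleftrightarrow> l \<in> partitions \<and> l 0 \<le> k"
proof -
  have "finite {i. case_nat k l i \<noteq> 0}" if "finite {i. l i \<noteq> 0}"
    by (rule finite_subset[OF support_case_nat]) (use that in simp)
  moreover have "finite {i. l i \<noteq> 0}" if "finite {i. case_nat k l i \<noteq> 0}"
    using finite_vimageI[OF that, of Suc] by (simp add: vimage_def)
  moreover have "antimono (case_nat k l) \<longleftrightarrow> antimono l \<and> l 0 \<le> k"
  proof
    assume *: "antimono (case_nat k l)"
    have "l (Suc i) \<le> l i" for i using antimonoD[OF *, of "Suc i" "Suc (Suc i)"] by simp
    then show "antimono l \<and> l 0 \<le> k"
      using antimonoD[OF *, of 0 "Suc 0"] by (simp add: antimono_iff_le_Suc)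
  next
    assume *: "antimono l \<and> l 0 \<le> k"
    have "case_nat k l (Suc i) \<le> case_nat k l i" for i
      using * antimonoD[of l] by (cases i) auto
    then show "antimono (case_nat k l)" by (simp add: antimono_iff_le_Suc)
  qed
  ultimately show ?thesis by (auto simp: partitions_def)
qed

lemma psize_case_nat:
  assumes "l \<in> partitions"
  shows "psize (case_nat k l) = k + psize l"
proof -
  have fin: "finite {i. l i \<noteq> 0}" using assms by (simp add: partitions_def)
  have "psize (case_nat k l) = sum (case_nat k l) (insert 0 (Suc ` {i. l i \<noteq> 0}))"
    unfolding psize_def using fin
    by (intro sum.mono_neutral_left support_case_nat) auto
  also have "\<dots> = k + psize l"
    using fin by (subst sum.insert) (auto simp: sum.reindex psize_def)
  finally show ?thesis .
qed

text \<open>The largest part is either at most \<open>N\<close> or equal to \<open>Suc N\<close>; in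
  the second case it is removed. The condition \<open>n < Suc N\<close> guards the subtraction on
  natural numbers.\<close>

lemma card_bounded_partitions_Suc:
  "card (bounded_partitions (Suc N) n) = card (bounded_partitions N n) +
     (if n < Suc N then 0 else card (bounded_partitions (Suc N) (n - Suc N)))"
proof -
  let ?A = "{l \<in> bounded_partitions (Suc N) n. l 0 = Suc N}"
  have "bounded_partitions (Suc N) n = bounded_partitions N n \<union> ?A"
    "bounded_partitions N n \<inter> ?A = {}"
    by (auto simp: bounded_partitions_def)
  then have "card (bounded_partitions (Suc N) n) = card (bounded_partitions N n) + card ?A"
    by (metis card_Un_disjoint finite_Un finite_bounded_partitions)
  moreover have "?A = (if n < Suc N then {} else case_nat (Suc N) ` bounded_partitions (Suc N) (n - Suc N))"
    (is "_ = ?B")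
  proof (rule set_eqI)
    fix l :: "nat \<Rightarrow> nat"
    have l: "l = case_nat (l 0) (\<lambda>i. l (Suc i))" by (auto split: nat.splits)
    have "l \<in> partitions \<longleftrightarrow> (\<lambda>i. l (Suc i)) \<in> partitions \<and> l (Suc 0) \<le> l 0"
      using case_nat_partition[of "l 0" "\<lambda>i. l (Suc i)"] by (simp only: l[symmetric])
    moreover have "psize l = l 0 + psize (\<lambda>i. l (Suc i))" if "(\<lambda>i. l (Suc i)) \<in> partitions"
      using psize_case_nat[OF that, of "l 0"] by (simp only: l[symmetric])
    ultimately have "l \<in> ?A \<longleftrightarrow> l 0 = Suc N \<and> Suc N \<le> n \<and>
        (\<lambda>i. l (Suc i)) \<in> bounded_partitions (Suc N) (n - Suc N)"
      by (auto simp: bounded_partitions_def)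
    also have "\<dots> \<longleftrightarrow> l \<in> ?B"
    proof
      assume *: "l 0 = Suc N \<and> Suc N \<le> n \<and>
        (\<lambda>i. l (Suc i)) \<in> bounded_partitions (Suc N) (n - Suc N)"
      then have "l \<in> case_nat (Suc N) ` bounded_partitions (Suc N) (n - Suc N)"
        using l by (intro image_eqI[where x = "\<lambda>i. l (Suc i)"]) auto
      with * show "l \<in> ?B" by simp
    qed (auto split: if_splits)
    finally show "l \<in> ?A \<longleftrightarrow> l \<in> ?B" .
  qed
  moreover have "inj_on (case_nat (Suc N)) A" for A :: "(nat \<Rightarrow> nat) set"
    by (rule inj_onI) (auto simp: fun_eq_iff split: nat.splits)
  ultimately show ?thesis by (simp add: card_image)
qed

section \<open>Euler's product as a limit of formal power series\<close>

definition bounded_partition_fps :: "nat \<Rightarrow> rat fps" where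
  "bounded_partition_fps N = Abs_fps (\<lambda>n. of_nat (card (bounded_partitions N n)))"

definition partition_fps :: "rat fps" where
  "partition_fps = Abs_fps (\<lambda>n. of_nat (card {l \<in> partitions. psize l = n}))"

text \<open>Removing the largest part \<open>N\<close> of a partition gives \<open>(1 - q\<^sup>N) P\<^sub>N = P\<^bsub>N-1\<^esub>\<close>
  for the generating function \<open>P\<^sub>N\<close> of partitions with parts at most \<open>N\<close>.\<close>

lemma bounded_partition_fps_Suc:
  "(1 - fps_X ^ Suc N) * bounded_partition_fps (Suc N) = bounded_partition_fps N"
proof (rule fps_ext)
  fix n
  show "fps_nth ((1 - fps_X ^ Suc N) * bounded_partition_fps (Suc N)) n = fps_nth (bounded_partition_fps N) n"
    unfolding left_diff_distrib fps_sub_nth mult_1_left fps_X_power_mult_nth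
    unfolding bounded_partition_fps_def fps_nth_Abs_fps card_bounded_partitions_Suc[of N n]
    by auto
qed

text \<open>The recursion telescopes down to the empty partition, which alone has all parts at most
  0.\<close>

lemma prod_mult_bounded_partition_fps: "(\<Prod>j<N. 1 - fps_X ^ Suc j) * bounded_partition_fps N = 1"
proof (induction N)
  case 0
  show ?case by (rule fps_ext) (simp add: bounded_partition_fps_def bounded_partitions_0)
next
  case (Suc N)
  then show ?case
    by (simp add: mult.assoc bounded_partition_fps_Suc del: power_Suc)
qed

lemma bounded_partitions_eq:
  assumes "n \<le> N"
  shows "bounded_partitions N n = {l \<in> partitions. psize l = n}"
proof -
  have "l 0 \<le> N" if "l \<in> partitions" "psize l = n" for l
    using partition_part_le_psize[OF that(1), of 0] that(2) assms by simp
  then show ?thesis unfolding bounded_partitions_def by blast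
qed

text \<open>Each coefficient is eventually constant: a bound \<open>N \<ge> n\<close> excludes no
  partition of \<open>n\<close>.\<close>

lemma bounded_partition_fps_tendsto: "bounded_partition_fps \<longlonglongrightarrow> partition_fps"
proof (rule tendsto_fpsI, rule eventually_sequentiallyI)
  show "fps_nth (bounded_partition_fps N) n = fps_nth partition_fps n" if "n \<le> N" for n N
    by (simp only: bounded_partition_fps_def partition_fps_def fps_nth_Abs_fps bounded_partitions_eq[OF that])
qed

lemma partition_fps_eq: "partition_fps = 1 / euler_prod"
proof -
  have "{l \<in> partitions. psize l = 0} = {\<lambda>i. 0}"
    using bounded_partitions_eq[of 0 0] bounded_partitions_0[of 0] by simp
  then have nz: "fps_nth partition_fps 0 \<noteq> 0"
    by (simp add: partition_fps_def)
  have "(\<Prod>j<N. 1 - fps_X ^ Suc j) = inverse (bounded_partition_fps N)" for N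
    by (rule fps_inverse_unique[symmetric])
      (subst mult.commute, rule prod_mult_bounded_partition_fps)
  \<comment> \<open>Inversion is continuous at a series with nonzero constant coefficient, here
    \<open>partition_fps\<close>.\<close>
  then have "(\<lambda>N. \<Prod>j<N. 1 - fps_X ^ Suc j) \<longlonglongrightarrow> inverse partition_fps"
    using tendsto_inverse_fps[OF bounded_partition_fps_tendsto nz] by (simp only:)
  \<comment> \<open>Besides convergence, \<open>raw_has_prod\<close> asks for a nonzero limit; an
    inverse vanishes only if the constant coefficient is 0.\<close>
  then have "(\<lambda>j. 1 - fps_X ^ Suc j) has_prod inverse partition_fps"
    unfolding has_prod_def raw_has_prod_def LIMSEQ_lessThan_iff_atMost
    using nz by (simp only: add_0_right fps_inverse_eq_0_iff simp_thms not_False_eq_True)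
  then have "euler_prod = inverse partition_fps"
    unfolding euler_prod_def by (rule has_prod_unique[symmetric])
  moreover have "1 / inverse partition_fps = partition_fps"
    using nz by (subst fps_divide_unit) simp_all
  ultimately show ?thesis by (simp only:)
qed

section \<open>Counting partitions class by class\<close>

lemma P_plus_subset_partitions: "P_plus \<subseteq> partitions"
  by (auto simp: P_plus_def)

text \<open>The classes of the members of \<open>P_plus\<close> of size \<open>n\<close> tile the
  partitions of \<open>n\<close>, and each has \<open>2 ^ kappa l\<close> elements.\<close>

lemma sum_two_power_kappa:
  "(\<Sum>l | l \<in> P_plus \<and> psize l = n. 2 ^ kappa l) = card {l \<in> partitions. psize l = n}"
proof -
  let ?A = "{l \<in> P_plus. psize l = n}"
  have fin: "finite ?A"
    by (rule finite_subset[OF _ finite_partitions_psize[of n]]) (use P_plus_subset_partitions in auto)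
  have A: "l \<in> partitions" if "l \<in> ?A" for l using that P_plus_subset_partitions by auto
  have "{l \<in> partitions. psize l = n} = (\<Union>l\<in>?A. flip_class l)"
  proof (intro subset_antisym subsetI)
    fix m assume "m \<in> {l \<in> partitions. psize l = n}"
    then have m: "m \<in> partitions" "psize m = n" by auto
    from flip_class_P_plus[OF m(1)] obtain l where l: "l \<in> flip_class m" "l \<in> P_plus" by blast
    then have "m \<in> flip_class l" "psize l = n"
      using flip_class_eq(1)[OF m(1) l(1)] self_in_flip_class[OF m(1)] psize_flip_class[OF m(1) l(1)] m(2)
      by auto
    with l show "m \<in> (\<Union>l\<in>?A. flip_class l)" by blast
  next
    fix m assume "m \<in> (\<Union>l\<in>?A. flip_class l)"
    then obtain l where l: "l \<in> ?A" "m \<in> flip_class l" by blast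
    with psize_flip_class[OF A[OF l(1)] l(2)] flip_class_subset
    show "m \<in> {l \<in> partitions. psize l = n}" by auto
  qed
  moreover have "card (\<Union>l\<in>?A. flip_class l) = (\<Sum>l\<in>?A. card (flip_class l))"
  proof (rule card_UN_disjoint[OF fin]; intro ballI impI)
    fix l assume "l \<in> ?A"
    \<comment> \<open>An infinite set has \<open>card\<close> 0, so the power of two also gives
      finiteness.\<close>
    have "card (flip_class l) \<noteq> 0" using card_flip_class[OF A[OF \<open>l \<in> ?A\<close>]] by simp
    then show "finite (flip_class l)" by (meson card.infinite)
  next
    fix l m assume lm: "l \<in> ?A" "m \<in> ?A" "l \<noteq> m"
    show "flip_class l \<inter> flip_class m = {}"
    proof (rule ccontr)
      assume "flip_class l \<inter> flip_class m \<noteq> {}"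
      \<comment> \<open>A common member makes the two classes equal, and one class would then hold
        two members of \<open>P_plus\<close>.\<close>
      then obtain n where n: "n \<in> flip_class l" "n \<in> flip_class m" by blast
      then have "flip_class l = flip_class m"
        using flip_class_eq(1)[OF A[OF lm(1)] n(1)] flip_class_eq(1)[OF A[OF lm(2)] n(2)] by simp
      then have "m \<in> flip_class l" "l \<in> flip_class l"
        using self_in_flip_class A lm by auto
      with lm flip_class_P_plus[OF A[OF lm(1)]] show False by blast
    qed
  qed
  moreover have "(\<Sum>l\<in>?A. card (flip_class l)) = (\<Sum>l\<in>?A. 2 ^ kappa l)"
    by (rule sum.cong) (auto simp: card_flip_class A)
  ultimately show ?thesis by simp
qed

text \<open>Only the finitely many partitions of size \<open>n\<close> contribute to the coefficient
  at \<open>n\<close>, so the sum is computed coefficientwise.\<close>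

lemma has_sum_P_plus:
  "((\<lambda>l. 2 ^ kappa l * fps_X ^ psize l :: rat fps) has_sum partition_fps) P_plus"
proof -
  have nth: "fps_nth (2 ^ kappa l * fps_X ^ psize l :: rat fps) n = (if psize l = n then 2 ^ kappa l else 0)"
    for l n
  proof -
    have "(2 ^ kappa l :: rat fps) = fps_const (2 ^ kappa l)"
      by (metis fps_const_power numeral_fps_const)
    then show ?thesis by (simp only: fps_mult_left_const_nth fps_X_power_nth) simp
  qed
  have supp: "{l \<in> P_plus. fps_nth (2 ^ kappa l * fps_X ^ psize l :: rat fps) n \<noteq> 0}
      = {l \<in> P_plus. psize l = n}" for n
    unfolding nth by auto
  show ?thesis
  proof (rule has_sum_fpsI; unfold supp)
    show "finite {l \<in> P_plus. psize l = n}" for n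
      by (rule finite_subset[OF _ finite_partitions_psize[of n]]) (use P_plus_subset_partitions in auto)
    show "fps_nth partition_fps n
      = (\<Sum>l | l \<in> P_plus \<and> psize l = n. fps_nth (2 ^ kappa l * fps_X ^ psize l :: rat fps) n)" for n
      unfolding nth by (simp add: partition_fps_def flip: sum_two_power_kappa)
  qed
qed

theorem theorem4p3:
  shows "partition_on partitions flip_classes
    \<and> (\<forall>C\<in>flip_classes.
          boolean_class C
        \<and> (\<exists>k. (\<forall>l\<in>C. kappa l = k) \<and> card C = 2 ^ k)
        \<and> (\<forall>l\<in>C. \<forall>m\<in>C. psize l = psize m)
        \<and> (\<exists>!l. l \<in> C \<and> l \<in> P_plus))
    \<and> ((\<lambda>l. 2 ^ kappa l * fps_X ^ psize l) has_sum (1 / euler_prod)) P_plus"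
proof (intro conjI ballI)
  show "partition_on partitions flip_classes" by (rule partition_on_flip_classes)
  show "((\<lambda>l. 2 ^ kappa l * fps_X ^ psize l) has_sum (1 / euler_prod)) P_plus"
    using has_sum_P_plus by (simp only: partition_fps_eq)
  fix C assume "C \<in> flip_classes"
  then obtain l where l: "l \<in> partitions" and C: "C = flip_class l" by (auto simp: flip_classes_def)
  show "boolean_class C" unfolding C by (rule boolean_flip_class[OF l])
  show "\<exists>!l. l \<in> C \<and> l \<in> P_plus" unfolding C by (rule flip_class_P_plus[OF l])
  have "\<forall>m\<in>C. kappa m = kappa l"
    using flip_class_eq(2)[OF l] by (simp add: C kappa_def)
  then show "\<exists>k. (\<forall>l\<in>C. kappa l = k) \<and> card C = 2 ^ k"
    using card_flip_class[OF l] C by blast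
  show "psize m = psize n" if "m \<in> C" "n \<in> C" for m n
    using that psize_flip_class[OF l] by (simp add: C)
qed

end
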